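(* For all integers $n\ge 0$, $\overline{p}_{\omega}(4n+3)\equiv0\pmod{4}$ and $\overline{p}_{\omega}(8n+6)\equiv0\pmod{4}$.
   Context: An overpartition of $n$ is a partition of $n$ in which the first occurrence of each distinct part may be overlined. $\overline{p}_{\omega}(n)$ denotes the number of overpartitions of $n$ in which the smallest part is overlined and all odd parts are less than twice the smallest part; equivalently $\sum_{n\ge1}\overline{p}_{\omega}(n)q^n=\sum_{n\ge1}\frac{q^n(-q^{n+1};q)_n(-q^{2n+2};q^2)_{\infty}}{(1-q^n)(q^{n+1};q)_n(q^{2n+2};q^2)_{\infty}}$, where $(a;q)_n=\prod_{j=0}^{n-1}(1-aq^j)$ and $(a;q)_\infty=\prod_{j\ge0}(1-aq^j)$. *)

theory Defs
  imports Main "HOL-Library.Multiset"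
begin

text \<open>An overpartition of n is represented as a pair (M, S): M is the multiset of
parts (positive naturals summing to n) and S is the set of distinct parts whose
first occurrence is overlined (so S is a subset of the set of parts).\<close>

definition overpartitions :: "nat \<Rightarrow> (nat multiset \<times> nat set) set" where
  "overpartitions n = {(M, S). (\<forall>x\<in>#M. 0 < x) \<and> sum_mset M = n \<and> S \<subseteq> set_mset M}"

definition pbar_omega :: "nat \<Rightarrow> nat" where
  "pbar_omega n = card {(M, S) \<in> overpartitions n.
      M \<noteq> {#} \<and> Min (set_mset M) \<in> S \<and>
      (\<forall>x\<in>#M. odd x \<longrightarrow> x < 2 * Min (set_mset M))}"

end

(* Modulo 4, only partitions with at most two distinct part sizes matter, so pbar_omega n is
   congruent to d(n) + 2 A, where A counts the solutions of a x + b y = n with a < b and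
   (b even or b < 2 a).  The parity of A comes from involutions that combine the exchange
   (a, b) <-> (x, y) with Euclidean steps; their fixed points are representations of n by the
   forms u^2 + v^2, u^2 + 2 v^2 and u^2 - 2 v^2, which the residue of n excludes (for the last
   two, within a suitable parity class of solutions).  For n = 3 mod 4
   what remains is the sum of the divisors of n, a multiple of 4; for n = 2 N with N = 3 mod 4,
   splitting the solutions by the parity of a reduces the count to solutions for N. *)

theory Submission
  imports Defs
begin

section \<open>Parity from fixed-point-free involutions\<close>

lemma even_card_if_involution:
  assumes "finite A"
    and "\<And>t. t \<in> A \<Longrightarrow> f t \<in> A" "\<And>t. t \<in> A \<Longrightarrow> f (f t) = t" "\<And>t. t \<in> A \<Longrightarrow> f t \<noteq> t"
  shows "even (card A)"
proof -
  \<comment> \<open>The orbits \<open>{t, f t}\<close> cut \<open>A\<close> into disjoint blocks of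
    size two, which is the form \<open>dvd_partition\<close> needs.\<close>
  let ?C = "(\<lambda>t. {t, f t}) ` A"
  have U: "\<Union>?C = A" using assms(2) by auto
  have "2 dvd card (\<Union>?C)"
  proof (rule dvd_partition)
    show "finite (\<Union>?C)" using U assms(1) by simp
    show "\<forall>c\<in>?C. 2 dvd card c"
    proof
      fix c assume "c \<in> ?C"
      then obtain t where "c = {t, f t}" "f t \<noteq> t" using assms(4) by blast
      then have "card c = 2" by (metis card_2_iff)
      then show "2 dvd card c" by simp
    qed
    have orbit: "{z, f z} = {t, f t}" if "z \<in> {t, f t}" "t \<in> A" for z t
      using that assms(3)[of t] by (metis empty_iff insert_commute insert_iff)
    show "\<forall>c1\<in>?C. \<forall>c2\<in>?C. c1 \<noteq> c2 \<longrightarrow> c1 \<inter> c2 = {}"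
    proof (intro ballI impI equals0I)
      fix c1 c2 z assume "c1 \<in> ?C" "c2 \<in> ?C" and ne: "c1 \<noteq> c2" and z: "z \<in> c1 \<inter> c2"
      then obtain s t where st: "c1 = {s, f s}" "c2 = {t, f t}" and "s \<in> A" "t \<in> A" by blast
      then have "{z, f z} = c1" "{z, f z} = c2" using z orbit[of z s] orbit[of z t] by blast+
      then show False using ne by blast
    qed
  qed
  then show ?thesis using U by simp
qed

subsection \<open>Solutions of a x + c b y = n\<close>

text \<open>For \<open>c = 1\<close> and \<open>a < b\<close> a solution is a partition of
  \<open>n\<close> into \<open>x\<close> copies of \<open>a\<close> and \<open>y\<close> copies of
  \<open>b\<close>. For \<open>c = 2\<close> the second size is even and \<open>b\<close> stands for
  half of it. Keeping all four entries as data lets sizes and multiplicities be exchanged.\<close>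

definition sols :: "nat \<Rightarrow> nat \<Rightarrow> (nat \<times> nat \<times> nat \<times> nat) set" where
  "sols c n = {(a, b, x, y). 0 < a \<and> 0 < b \<and> 0 < x \<and> 0 < y \<and> a * x + c * (b * y) = n}"

lemma finite_sols: "0 < c \<Longrightarrow> finite (sols c n)"
proof (rule finite_subset)
  assume c: "0 < c"
  show "sols c n \<subseteq> {..n} \<times> {..n} \<times> {..n} \<times> {..n}"
  proof (clarsimp simp: sols_def)
    fix a b x y :: nat assume "0 < a" "0 < b" "0 < x" "0 < y"
    then have "a \<le> a * x" "x \<le> a * x" "b \<le> b * y" "y \<le> b * y" "b * y \<le> c * (b * y)" using c by auto
    then show "a \<le> a * x + c * (b * y) \<and> b \<le> a * x + c * (b * y) \<and> x \<le> a * x + c * (b * y) \<and> y \<le> a * x + c * (b * y)" by linarith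
  qed
qed simp

section \<open>Squares modulo 4 and 8\<close>

lemma square_mod_4: "(x::nat)\<^sup>2 mod 4 = (if even x then 0 else 1)"
proof (cases "even x")
  case True then show ?thesis by (auto elim!: evenE simp: power2_eq_square)
next
  case False
  then obtain k where "x = 2 * k + 1" by (auto elim!: oddE)
  then have "x\<^sup>2 = 4 * (k * k + k) + 1" by (simp add: power2_eq_square algebra_simps)
  then show ?thesis using False by simp
qed

lemma odd_square_mod_8: "odd (x::nat) \<Longrightarrow> x\<^sup>2 mod 8 = 1"
proof -
  assume "odd x"
  then obtain k where k: "x = 2 * k + 1" by (auto elim!: oddE)
  have "even (k * k + k)" by simp
  then obtain j where "k * k + k = 2 * j" by (elim evenE)
  moreover have "x\<^sup>2 = 4 * (k * k + k) + 1" using k by (simp add: power2_eq_square algebra_simps)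
  ultimately have "x\<^sup>2 = 8 * j + 1" by simp
  then show ?thesis by simp
qed

lemma add_double_square_mod_8:
  fixes n x :: nat
  shows "(n + 2 * x\<^sup>2) mod 8 = (n mod 8 + (if even x then 0 else 2)) mod 8"
proof -
  have "(2 * x\<^sup>2) mod 8 = 2 * (x\<^sup>2 mod 4)" using mult_mod_right[of 2 "x\<^sup>2" 4] by simp
  then have "(2 * x\<^sup>2) mod 8 = (if even x then 0 else 2)" by (simp add: square_mod_4)
  then show ?thesis using mod_add_eq[of n 8 "2 * x\<^sup>2"] by simp
qed

lemma sum_two_squares_mod:
  assumes "(n::nat) mod 4 = 3 \<or> n mod 8 = 6" shows "u\<^sup>2 + v\<^sup>2 \<noteq> n"
proof
  assume n: "u\<^sup>2 + v\<^sup>2 = n"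
  show False
  proof (cases "n mod 4 = 3")
    case True
    have "n mod 4 = (u\<^sup>2 mod 4 + v\<^sup>2 mod 4) mod 4" using n by (simp add: mod_add_eq)
    then show False using True by (simp add: square_mod_4 split: if_splits)
  next
    case False
    then have 6: "n mod 8 = 6" using assms by simp
    then have "n mod 4 = 2" by presburger
    moreover have "n mod 4 = (u\<^sup>2 mod 4 + v\<^sup>2 mod 4) mod 4" using n by (simp add: mod_add_eq)
    ultimately have "odd u" "odd v" by (auto simp add: square_mod_4 split: if_splits)
    then have "u\<^sup>2 mod 8 = 1" "v\<^sup>2 mod 8 = 1" using odd_square_mod_8 by blast+
    moreover have "n mod 8 = (u\<^sup>2 mod 8 + v\<^sup>2 mod 8) mod 8" using n by (simp add: mod_add_eq)
    ultimately show False using 6 by simp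
  qed
qed

text \<open>The region \<open>a < b < 2 * a\<close> is parametrized by positive
  \<open>d = 2 * a - b\<close> and \<open>c = b - a\<close>, with \<open>a = d + c\<close> and
  \<open>b = d + 2 * c\<close>. Then \<open>a * x + b * y = (x + y) * d + (x + 2 * y) * c\<close>.
  The matrix of this substitution is symmetric, so exchanging the pairs \<open>(d, c)\<close> and
  \<open>(x, y)\<close> gives an involution. A fixed point would yield
  \<open>n = (x + y)^2 + y^2\<close>.\<close>

lemma even_card_between:
  assumes n: "n mod 4 = 3 \<or> n mod 8 = 6"
  shows "even (card {(a, b, x, y) \<in> sols 1 n. a < b \<and> b < 2 * a})" (is "even (card ?E)")
proof -
  define f where "f = (\<lambda>(a, b, x, y). (x + y, x + 2 * y, 2 * a - b, b - a) :: nat \<times> nat \<times> nat \<times> nat)"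
  have eq: "(x + y) * (2 * a - b) + (x + 2 * y) * (b - a) = a * x + b * y" if "a < b" "b < 2 * a" for a b x y :: nat
  proof -
    define c d where "c = b - a" and "d = 2 * a - b"
    then have "a = c + d" "b = c + d + c" using that by auto
    then show ?thesis by (simp add: algebra_simps)
  qed
  show ?thesis
  proof (rule even_card_if_involution[where f = f])
    show "finite ?E" by (rule finite_subset[OF _ finite_sols[of 1 n]]) auto
    fix t assume t: "t \<in> ?E"
    show "f t \<in> ?E" using t eq by (auto simp: f_def sols_def)
    show "f (f t) = t" using t by (auto simp: f_def)
    show "f t \<noteq> t"
    proof
      assume ft: "f t = t"
      obtain a b x y where tt: "t = (a, b, x, y)" by (cases t)
      then have "a = x + y" "b = x + 2 * y" using ft by (auto simp: f_def)
      moreover have "a * x + b * y = n" using t tt by (simp add: sols_def)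
      ultimately have "(x + y)\<^sup>2 + y\<^sup>2 = n" by (simp add: power2_eq_square algebra_simps)
      then show False using sum_two_squares_mod n by blast
    qed
  qed
qed

section \<open>Codivisor pairs for n = 3 mod 4, and the diagonal a = e\<close>

lemma sum_divisors_mod_4_eq_3:
  fixes g :: "nat \<Rightarrow> nat"
  assumes n: "n mod 4 = 3"
  shows "(\<Sum>m | m dvd n. g m) = (\<Sum>m | m dvd n \<and> m mod 4 = 1. g m + g (n div m))"
proof -
  have n0: "0 < n" using n by (cases n) auto
  then have fin: "finite {m. m dvd n}" by simp
  have cases: "m mod 4 = 1 \<and> (n div m) mod 4 = 3 \<or> m mod 4 = 3 \<and> (n div m) mod 4 = 1" if "m dvd n" for m
  proof -
    have "m * (n div m) mod 4 = 3" using that n by simp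
    then have "(m mod 4) * (n div m mod 4) mod 4 = 3" by (metis mod_mult_eq)
    moreover have "m mod 4 < 4" "n div m mod 4 < 4" by auto
    then have "m mod 4 \<in> {0,1,2,3}" "n div m mod 4 \<in> {0,1,2,3}" by auto
    ultimately show ?thesis by auto
  qed
  have dd: "n div (n div m) = m \<and> n div m dvd n" if "m dvd n" for m
    using that n0 by (auto elim!: dvdE)
  have "(\<Sum>m | m dvd n. g m) = (\<Sum>m | m dvd n \<and> m mod 4 = 1. g m) + (\<Sum>m | m dvd n \<and> m mod 4 = 3. g m)"
    using fin cases by (subst sum.union_disjoint[symmetric]) (auto intro!: sum.cong)
  \<comment> \<open>Passing to the codivisor exchanges the residue classes 1 and 3 modulo 4.\<close>
  also have "(\<Sum>m | m dvd n \<and> m mod 4 = 3. g m) = (\<Sum>m | m dvd n \<and> m mod 4 = 1. g (n div m))"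
  proof (rule sum.reindex_bij_witness[where i = "\<lambda>m. n div m" and j = "\<lambda>m. n div m"])
    fix m assume "m \<in> {m. m dvd n \<and> m mod 4 = 3}"
    then show "n div (n div m) = m" "n div m \<in> {m. m dvd n \<and> m mod 4 = 1}" "g (n div (n div m)) = g m"
      using dd[of m] cases[of m] by auto
  next
    fix m assume "m \<in> {m. m dvd n \<and> m mod 4 = 1}"
    then show "n div (n div m) = m" "n div m \<in> {m. m dvd n \<and> m mod 4 = 3}"
      using dd[of m] cases[of m] by auto
  qed
  finally show ?thesis by (simp add: sum.distrib)
qed

text \<open>For the codivisor \<open>k\<close> of \<open>m\<close>,
  \<open>n + 1 - (m + k) = (m - 1) * (k - 1)\<close>; the first factor is a multiple of 4 and the
  second is even.\<close>

lemma codivisor_mod: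
  fixes n :: nat
  assumes "m dvd n" "m mod 4 = 1" "n mod 4 = 3"
  shows "(n div m) mod 4 = 3" and "(m + n div m) mod 8 = (n + 1) mod 8"
proof -
  define i where "i = m div 4"
  define k where "k = n div m"
  define j where "j = k div 4"
  have m: "m = 4 * i + 1" using assms(2) by (simp add: i_def, presburger)
  have n: "n = m * k" using assms by (simp add: k_def)
  then have "n = k + 4 * (i * k)" by (simp add: m)
  then have "k mod 4 = 3" using assms(3) by simp
  then have k: "k = 4 * j + 3" by (simp add: j_def, presburger)
  show "(n div m) mod 4 = 3" using \<open>k mod 4 = 3\<close> by (simp add: k_def)
  have "n + 1 = (m + k) + 8 * (2 * i * j + i)" unfolding n by (simp add: m k algebra_simps)
  then show "(m + n div m) mod 8 = (n + 1) mod 8" unfolding k_def[symmetric] by (metis mod_mult_self2)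
qed

text \<open>With \<open>a = e\<close> the equation reads \<open>a * (x + 2 * y) = n\<close>, so a
  solution amounts to a divisor \<open>m = x + 2 * y\<close> and a positive \<open>y\<close> with
  \<open>2 * y < m\<close>. The predicate \<open>P\<close> allows both a parity restriction on
  \<open>y\<close> and no restriction.\<close>

lemma card_diagonal:
  assumes "0 < n"
  shows "card {(a, e, x, y) \<in> sols 2 n. a = e \<and> P y} = (\<Sum>m | m dvd n. card {y. 0 < y \<and> 2 * y < m \<and> P y})"
    (is "card ?D = _")
proof -
  let ?S = "SIGMA m:{m. m dvd n}. {y. 0 < y \<and> 2 * y < m \<and> P y}"
  have "card ?D = card ?S"
  proof (rule bij_betw_same_card, rule bij_betw_byWitness)
    let ?f = "\<lambda>(a, e, x, y). (x + 2 * y, y) :: nat \<times> nat"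
    let ?g = "\<lambda>(m, y). (n div m, n div m, m - 2 * y, y) :: nat \<times> nat \<times> nat \<times> nat"
    have eq: "a * x + 2 * (a * y) = a * (x + 2 * y)" for a x y :: nat by (simp add: algebra_simps)
    show "\<forall>t\<in>?D. ?g (?f t) = t" by (auto simp: sols_def eq)
    show "\<forall>t\<in>?S. ?f (?g t) = t" by auto
    show "?f ` ?D \<subseteq> ?S" by (auto simp: sols_def eq)
    show "?g ` ?S \<subseteq> ?D"
    proof clarify
      fix m y assume "m dvd n" "0 < y" "2 * y < m" "P y"
      moreover from this have "n div m * (m - 2 * y) + 2 * (n div m * y) = n" by (simp add: eq)
      moreover have "0 < n div m" using \<open>m dvd n\<close> assms by (auto simp: dvd_div_eq_0_iff)
      ultimately show "(n div m, n div m, m - 2 * y, y) \<in> sols 2 n \<and> n div m = n div m \<and> P y"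
        unfolding sols_def by simp
    qed
  qed
  also have "\<dots> = (\<Sum>m | m dvd n. card {y. 0 < y \<and> 2 * y < m \<and> P y})"
    by (rule card_SigmaI) (use assms in \<open>auto intro!: finite_subset[of _ "{..n}"] simp: Suc_le_eq dest!: dvd_imp_le\<close>)
  finally show ?thesis .
qed

subsection \<open>Solutions of a x + 2 e y = n\<close>

lemma card_half_mod_2:
  fixes m :: nat
  shows "card {y. 0 < y \<and> 2 * y < m \<and> even y} = (m - 1) div 4"
    and "card {y. 0 < y \<and> 2 * y < m \<and> odd y} = (m + 1) div 4"
    and "card {y. 0 < y \<and> 2 * y < m} = (m - 1) div 2"
proof -
  have "{y. 0 < y \<and> 2 * y < m \<and> even y} = (\<lambda>j. 2 * j + 2) ` {..<(m - 1) div 4}"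
  proof (intro set_eqI iffI)
    fix y assume y: "y \<in> {y. 0 < y \<and> 2 * y < m \<and> even y}"
    then obtain k where "y = 2 * k" by (auto elim: evenE)
    then have "y = 2 * (k - 1) + 2" "k - 1 < (m - 1) div 4" using y by auto
    then show "y \<in> (\<lambda>j. 2 * j + 2) ` {..<(m - 1) div 4}" by blast
  qed auto
  then show "card {y. 0 < y \<and> 2 * y < m \<and> even y} = (m - 1) div 4"
    by (simp add: card_image inj_on_def)
  have "{y. 0 < y \<and> 2 * y < m \<and> odd y} = (\<lambda>j. 2 * j + 1) ` {..<(m + 1) div 4}"
  proof (intro set_eqI iffI)
    fix y assume y: "y \<in> {y. 0 < y \<and> 2 * y < m \<and> odd y}"
    then obtain k where "y = 2 * k + 1" by (auto elim: oddE)
    then have "y = 2 * k + 1" "k < (m + 1) div 4" using y by auto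
    then show "y \<in> (\<lambda>j. 2 * j + 1) ` {..<(m + 1) div 4}" by blast
  qed auto
  then show "card {y. 0 < y \<and> 2 * y < m \<and> odd y} = (m + 1) div 4"
    by (simp add: card_image inj_on_def)
  have "{y. 0 < y \<and> 2 * y < m} = {1..(m - 1) div 2}" by auto
  then show "card {y. 0 < y \<and> 2 * y < m} = (m - 1) div 2" by simp
qed

text \<open>Since \<open>e = a\<close> is odd, the condition on \<open>y\<close> is the parity class
  \<open>even (e + y) = (n mod 8 = 7)\<close> restricted to the diagonal. Codivisors
  \<open>m = 4 * i + 1\<close> and \<open>k = 4 * j + 3\<close> together contribute
  \<open>i + j\<close> if \<open>n mod 8 = 3\<close> and \<open>i + j + 1\<close> if
  \<open>n mod 8 = 7\<close>. The congruence of \<open>m + k\<close> and \<open>n + 1\<close> modulo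
  8 makes this even in both cases.\<close>

lemma even_card_diagonal:
  assumes n: "n mod 4 = 3"
  shows "even (card {(a, e, x, y) \<in> sols 2 n. a = e \<and> (even y \<longleftrightarrow> n mod 8 = 3)})"
proof -
  have n0: "0 < n" using n by (cases n) auto
  define g where "g = (\<lambda>m. card {y::nat. 0 < y \<and> 2 * y < m \<and> (even y \<longleftrightarrow> n mod 8 = 3)})"
  have "even (g m + g (n div m))" if "m dvd n" "m mod 4 = 1" for m
  proof -
    define k where "k = n div m"
    have k: "k mod 4 = 3" and s: "(m + k) mod 8 = (n + 1) mod 8"
      using codivisor_mod[OF that n] by (simp_all add: k_def)
    define i j where "i = m div 4" and "j = k div 4"
    have mk: "m = 4 * i + 1" "k = 4 * j + 3"
      using div_mult_mod_eq[of m 4] div_mult_mod_eq[of k 4] that(2) k by (simp_all add: i_def j_def)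
    then have "m + k = 4 * (i + j + 1)" by simp
    then have "(m + k) mod 8 = 4 * ((i + j + 1) mod 2)" by (simp only: mult_mod_right) simp
    then have ij: "(n + 1) mod 8 = 4 * ((i + j + 1) mod 2)" using s by simp
    have "n mod 8 = 3 \<or> n mod 8 = 7" using n by presburger
    then show ?thesis
    proof
      assume n8: "n mod 8 = 3"
      then have "(n + 1) mod 8 = 4" by (simp add: mod_Suc)
      then have "even (i + j)" using ij by (simp add: mod2_eq_if split: if_splits)
      moreover have "g m + g k = i + j"
        using n8 by (simp add: g_def card_half_mod_2) (simp add: mk)
      ultimately show ?thesis unfolding k_def[symmetric] by simp
    next
      assume n8: "n mod 8 = 7"
      then have "(n + 1) mod 8 = 0" by (simp add: mod_Suc)
      then have "even (i + j + 1)" using ij by (simp add: mod2_eq_if split: if_splits)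
      moreover have "g m + g k = i + j + 1"
        using n8 card_half_mod_2(2) by (simp add: g_def) (simp add: mk)
      ultimately show ?thesis unfolding k_def[symmetric] by simp
    qed
  qed
  then have "even (\<Sum>m | m dvd n \<and> m mod 4 = 1. g m + g (n div m))" by (intro dvd_sum) auto
  then show ?thesis using card_diagonal[OF n0] sum_divisors_mod_4_eq_3[OF n, of g] by (simp add: g_def)
qed

text \<open>A Euclidean step, \<open>a * x + 2 * e * y = (a - 2 * e) * x + 2 * e * (x + y)\<close>,
  followed by the exchange of the two pairs. It replaces \<open>e + y\<close> by
  \<open>x + y + e\<close>, and \<open>x\<close> is odd because \<open>n\<close> is, so the parity
  class flips.\<close>

lemma card_left_eq_right:
  assumes "odd n"
  shows "card {(a, e, x, y) \<in> sols 2 n. 2 * e < a \<and> even (e + y) = d}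
    = card {(a, e, x, y) \<in> sols 2 n. a < e \<and> odd (e + y) = d}"
    (is "card ?L = card ?R")
proof -
  define f g where "f = (\<lambda>(a, e, x, y). (x, x + y, a - 2 * e, e) :: nat \<times> nat \<times> nat \<times> nat)"
    and "g = (\<lambda>(a, e, x, y). (x + 2 * y, y, a, e - a) :: nat \<times> nat \<times> nat \<times> nat)"
  note fg = this
  have "bij_betw f ?L ?R"
  proof (rule bij_betw_byWitness[where f' = g])
    show "\<forall>t\<in>?L. g (f t) = t" by (auto simp: fg)
    show "\<forall>t\<in>?R. f (g t) = t" by (auto simp: fg)
    show "f ` ?L \<subseteq> ?R"
    proof (rule image_subsetI)
      fix t assume "t \<in> ?L"
      then obtain a e x y where t: "t = (a, e, x, y)" and s: "(a, e, x, y) \<in> sols 2 n"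
        and "2 * e < a" and p: "even (e + y) = d" by auto
      define c where "c = a - 2 * e"
      then have a: "a = 2 * e + c" "0 < c" using \<open>2 * e < a\<close> by auto
      have "odd x" using s \<open>odd n\<close> by (auto simp: sols_def)
      then have "odd (x + y + e) = d" using p by auto
      moreover have "(x, x + y, c, e) \<in> sols 2 n"
        using s a unfolding sols_def by (simp add: algebra_simps)
      moreover have "f t = (x, x + y, c, e)" by (simp add: f_def t c_def)
      moreover have "x < x + y" using s by (simp add: sols_def)
      ultimately show "f t \<in> ?R" by simp
    qed
    show "g ` ?R \<subseteq> ?L"
    proof (rule image_subsetI)
      fix t assume "t \<in> ?R"
      then obtain a e x y where t: "t = (a, e, x, y)" and s: "(a, e, x, y) \<in> sols 2 n"
        and "a < e" and p: "odd (e + y) = d" by auto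
      define c where "c = e - a"
      then have e: "e = a + c" "0 < c" using \<open>a < e\<close> by auto
      have "odd a" using s \<open>odd n\<close> by (auto simp: sols_def)
      then have "even (y + c) = d" using p e by auto
      moreover have "(x + 2 * y, y, a, c) \<in> sols 2 n"
        using s e unfolding sols_def by (simp add: algebra_simps)
      moreover have "g t = (x + 2 * y, y, a, c)" by (simp add: g_def t c_def)
      moreover have "2 * y < x + 2 * y" using s by (simp add: sols_def)
      ultimately show "g t \<in> ?L" by simp
    qed
  qed
  then show ?thesis by (rule bij_betw_same_card)
qed

text \<open>A fixed point of the exchange has \<open>x = a\<close> and \<open>y = e\<close>, so
  \<open>e + y\<close> is even and the class forces \<open>n mod 8 = 7\<close>. But then
  \<open>n = a^2 + 2 * e^2\<close> with \<open>a\<close> odd, which is 1 or 3 modulo 8.\<close>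

lemma even_card_parity_class:
  assumes n: "n mod 4 = 3"
  shows "even (card {(a, e, x, y) \<in> sols 2 n. even (e + y) = (n mod 8 = 7)})" (is "even (card ?T)")
proof -
  define f where "f = (\<lambda>(a, e, x, y). (x, y, a, e) :: nat \<times> nat \<times> nat \<times> nat)"
  show ?thesis
  proof (rule even_card_if_involution[where f = f])
    show "finite ?T" by (rule finite_subset[OF _ finite_sols[of 2 n]]) auto
    fix t assume "t \<in> ?T"
    then obtain a e x y where t: "t = (a, e, x, y)" "(a, e, x, y) \<in> sols 2 n"
      and p: "even (e + y) = (n mod 8 = 7)" by auto
    have eq: "0 < a" "0 < e" "0 < x" "0 < y" "a * x + 2 * (e * y) = n" using t(2) by (simp_all add: sols_def)
    then have "(x, y, a, e) \<in> sols 2 n" by (simp add: sols_def mult.commute)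
    moreover have "even (y + e) = (n mod 8 = 7)" using p by (simp add: add.commute)
    ultimately show "f t \<in> ?T" by (simp add: t(1) f_def)
    show "f (f t) = t" by (simp add: t(1) f_def)
    show "f t \<noteq> t"
    proof
      assume "f t = t"
      then have "(x, y, a, e) = (a, e, x, y)" by (simp only: t(1) f_def prod.case)
      then have xy: "x = a" "y = e" by blast+
      then have "n mod 8 = 7" using p by simp
      have n_eq: "n = a\<^sup>2 + 2 * e\<^sup>2" using eq(5) xy by (simp add: power2_eq_square)
      moreover have "odd n" using n by presburger
      ultimately have "odd a" by simp
      then have a: "a\<^sup>2 mod 8 = 1" by (rule odd_square_mod_8)
      have "n mod 8 = (1 + (if even e then 0 else 2)) mod 8"
        unfolding n_eq add_double_square_mod_8 a ..
      then show False using \<open>n mod 8 = 7\<close> by (simp split: if_splits)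
    qed
  qed
qed

text \<open>The region \<open>e < a < 2 * e\<close> is parametrized by \<open>c = a - e\<close> and
  \<open>d = 2 * e - a\<close>, and
  \<open>a * x + 2 * e * y = (x + 2 * y) * d + 2 * (x + y) * c\<close>. Exchanging
  \<open>(d, c)\<close> with \<open>(x, y)\<close> preserves the parity class because
  \<open>d\<close> and \<open>x\<close> are odd.\<close>

lemma even_card_straight:
  assumes n: "n mod 4 = 3"
  shows "even (card {(a, e, x, y) \<in> sols 2 n. e < a \<and> a < 2 * e \<and> even (e + y) = (n mod 8 = 7)})"
    (is "even (card ?S)")
proof -
  have n8: "n mod 8 = 3 \<or> n mod 8 = 7" using n by presburger
  have "odd n" using n by presburger
  define f where "f = (\<lambda>(a, e, x, y). (x + 2 * y, x + y, 2 * e - a, a - e) :: nat \<times> nat \<times> nat \<times> nat)"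
  show ?thesis
  proof (rule even_card_if_involution[where f = f])
    show "finite ?S" by (rule finite_subset[OF _ finite_sols[of 2 n]]) auto
    fix t assume "t \<in> ?S"
    then obtain a e x y where t: "t = (a, e, x, y)" and s: "(a, e, x, y) \<in> sols 2 n"
      and ae: "e < a" "a < 2 * e" and p: "even (e + y) = (n mod 8 = 7)" by auto
    define c d where "c = a - e" and "d = 2 * e - a"
    note cd_def = this
    have cd: "a = d + 2 * c" "e = c + d" "0 < c" "0 < d" using ae by (auto simp: cd_def)
    have sol: "0 < x" "0 < y" "a * x + 2 * (e * y) = n" using s by (auto simp: sols_def)
    have "odd (a * x)" unfolding sol(3)[symmetric] using \<open>odd n\<close> sol(3) by auto
    then have "odd d" "odd x" using cd(1) by auto
    then have "even (x + y + c) = (n mod 8 = 7)" using p cd(2) by auto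
    moreover have "(x + 2 * y) * d + 2 * ((x + y) * c) = n"
      unfolding sol(3)[symmetric] cd(1,2) by (simp add: algebra_simps)
    moreover have ft: "f t = (x + 2 * y, x + y, d, c)" by (simp add: f_def t cd_def)
    ultimately show "f t \<in> ?S" using sol(1,2) cd(3,4) by (simp add: sols_def)
    show "f (f t) = t" unfolding ft by (simp add: f_def t cd(1,2))
    show "f t \<noteq> t"
    proof
      assume "f t = t"
      then have "(x + 2 * y, x + y, d, c) = (a, e, x, y)" unfolding ft[symmetric] by (simp only: t)
      then have e: "e = x + y" and a: "a = x + 2 * y" by blast+
      \<comment> \<open>A fixed point represents \<open>n\<close> as \<open>u^2 - 2 * y^2\<close>
        with \<open>u = x + 2 * y\<close> odd. Modulo 8 this leaves only \<open>n mod 8 = 7\<close>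
        with \<open>y\<close> odd; then \<open>e = x + y\<close> is even and \<open>e + y\<close> is
        odd, outside the class.\<close>
      have "(x + 2 * y)\<^sup>2 = n + 2 * y\<^sup>2"
        unfolding sol(3)[symmetric] a e by (simp add: power2_eq_square algebra_simps)
      moreover have "(x + 2 * y)\<^sup>2 mod 8 = 1" using \<open>odd x\<close> by (intro odd_square_mod_8) simp
      ultimately have "(n mod 8 + (if even y then 0 else 2)) mod 8 = 1"
        by (simp only: add_double_square_mod_8)
      then have "n mod 8 = 7 \<and> odd y" using n8 by (auto split: if_splits)
      then show False using p e \<open>odd x\<close> by auto
    qed
  qed
qed

text \<open>
  Let \<open>d\<close> be the parity class of \<open>e + y\<close> for which the exchange \<open>(a, e) \<leftrightarrow> (x, y)\<close> has no
  fixed point. Within this class, the solutions with \<open>a > 2 * e\<close> correspond to those with \<open>a < e\<close>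
  in the opposite class, so the two classes with \<open>a < e\<close> together have the parity of the solutions
  with \<open>e \<le> a < 2 * e\<close> in class \<open>d\<close>, which is even.
\<close>

lemma even_card_right:
  assumes n: "n mod 4 = 3"
  shows "even (card {(a, e, x, y) \<in> sols 2 n. a < e})"
proof -
  define d where "d \<longleftrightarrow> n mod 8 = 7"
  have "odd n" using n by presburger
  have n8: "n mod 8 = 3 \<or> n mod 8 = 7" using n by presburger
  define T where "T = {(a, e, x, y) \<in> sols 2 n. even (e + y) = d}"
  define R where "R = {(a, e, x, y) \<in> sols 2 n. a < e \<and> even (e + y) = d}"
  define R' where "R' = {(a, e, x, y) \<in> sols 2 n. a < e \<and> odd (e + y) = d}"
  define D where "D = {(a, e, x, y) \<in> sols 2 n. a = e \<and> even (e + y) = d}"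
  define S where "S = {(a, e, x, y) \<in> sols 2 n. e < a \<and> a < 2 * e \<and> even (e + y) = d}"
  define L where "L = {(a, e, x, y) \<in> sols 2 n. 2 * e < a \<and> even (e + y) = d}"
  note defs = T_def R_def R'_def D_def S_def L_def
  have fin: "finite T" "finite R" "finite R'" "finite D" "finite S" "finite L"
    unfolding defs by (auto intro: finite_subset[OF _ finite_sols[of 2 n]])
  have odd: "odd a \<and> odd x" if "(a, e, x, y) \<in> sols 2 n" for a e x y
    using that \<open>odd n\<close> by (auto simp: sols_def)
  have "even (card T)" using even_card_parity_class[OF n] by (simp add: T_def d_def)
  moreover have "even (card S)" using even_card_straight[OF n] by (simp add: S_def d_def)
  moreover have "even (card D)"
  proof -
    have "D = {(a, e, x, y) \<in> sols 2 n. a = e \<and> (even y \<longleftrightarrow> n mod 8 = 3)}"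
      unfolding D_def d_def using n8 by (auto dest: odd)
    then show ?thesis using even_card_diagonal[OF n] by simp
  qed
  moreover have "card L = card R'"
    unfolding L_def R'_def by (rule card_left_eq_right) fact
  moreover have "card T = card R + card D + card S + card L"
  proof -
    have "T = R \<union> D \<union> S \<union> L"
    proof (intro set_eqI iffI)
      fix t assume t: "t \<in> T"
      obtain a e x y where tt: "t = (a, e, x, y)" by (cases t)
      then have "odd a" using t odd by (auto simp: T_def)
      then have "a \<noteq> 2 * e" by auto
      then consider "a < e" | "a = e" | "e < a \<and> a < 2 * e" | "2 * e < a" by linarith
      then show "t \<in> R \<union> D \<union> S \<union> L" using t unfolding tt defs by cases auto
    qed (auto simp: defs)
    moreover have "R \<inter> D = {}" "(R \<union> D) \<inter> S = {}" "(R \<union> D \<union> S) \<inter> L = {}" by (auto simp: defs)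
    ultimately show ?thesis using fin by (simp add: card_Un_disjoint)
  qed
  ultimately have "even (card R + card R')" by auto
  moreover have "{(a, e, x, y) \<in> sols 2 n. a < e} = R \<union> R'" "R \<inter> R' = {}" by (auto simp: defs)
  ultimately show ?thesis using fin by (simp add: card_Un_disjoint)
qed

text \<open>Adding \<open>card_left_eq_right\<close> over both parity classes turns this count into
  that of \<open>even_card_right\<close>. It serves as the correction term in the passage from
  \<open>2 * N\<close> to \<open>N\<close>.\<close>

lemma even_card_left:
  assumes n: "n mod 4 = 3"
  shows "even (card {(a, e, x, y) \<in> sols 2 n. 2 * e < a})"
proof -
  have "odd n" using n by presburger
  define L where "L = (\<lambda>d. {(a, e, x, y) \<in> sols 2 n. 2 * e < a \<and> even (e + y) = d})"
  define R where "R = (\<lambda>d. {(a, e, x, y) \<in> sols 2 n. a < e \<and> odd (e + y) = d})"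
  have fin: "finite (L d)" "finite (R d)" for d
    unfolding L_def R_def by (auto intro: finite_subset[OF _ finite_sols[of 2 n]])
  have "{(a, e, x, y) \<in> sols 2 n. 2 * e < a} = L True \<union> L False" "L True \<inter> L False = {}"
    by (auto simp: L_def)
  then have l: "card {(a, e, x, y) \<in> sols 2 n. 2 * e < a} = card (L True) + card (L False)"
    using fin by (simp add: card_Un_disjoint)
  have "{(a, e, x, y) \<in> sols 2 n. a < e} = R True \<union> R False" "R True \<inter> R False = {}"
    by (auto simp: R_def)
  then have r: "card {(a, e, x, y) \<in> sols 2 n. a < e} = card (R True) + card (R False)"
    using fin by (simp add: card_Un_disjoint)
  have "card (L d) = card (R d)" for d
    unfolding L_def R_def by (rule card_left_eq_right) fact
  then show ?thesis using even_card_right[OF n] l r by simp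
qed

section \<open>Passage from 2 N to N, and the split by the larger size\<close>

lemma even_card_equal:
  assumes "odd n"
  shows "even (card {(a, b, x, y) \<in> sols 1 n. a = b})" (is "even (card ?D)")
proof -
  define f where "f = (\<lambda>(a, b, x, y). (a, b, y, x) :: nat \<times> nat \<times> nat \<times> nat)"
  show ?thesis
  proof (rule even_card_if_involution[where f = f])
    show "finite ?D" by (rule finite_subset[OF _ finite_sols[of 1 n]]) auto
    fix t assume "t \<in> ?D"
    then obtain a x y where t: "t = (a, a, x, y)" "(a, a, x, y) \<in> sols 1 n" by auto
    then show "f t \<in> ?D" by (simp add: f_def sols_def add.commute)
    show "f (f t) = t" by (simp add: f_def t(1))
    \<comment> \<open>A fixed point has \<open>x = y\<close>, so \<open>n = 2 * a * x\<close> would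
      be even.\<close>
    show "f t \<noteq> t" using t \<open>odd n\<close> by (auto simp: f_def sols_def)
  qed
qed

text \<open>
  On the left, split by the parity of \<open>a\<close> and halve \<open>a\<close> or \<open>x\<close>. The correction term removes
  the solutions for \<open>N\<close> with \<open>a\<close> even.
\<close>

lemma card_sols_double:
  assumes "odd N"
  shows "card {(a, e, x, y) \<in> sols 2 (2 * N). a \<le> e} + card {(a, e, x, y) \<in> sols 2 N. 2 * e < a} =
    2 * card {(a, b, x, y) \<in> sols 1 N. 2 * a \<le> b} + card {(a, b, x, y) \<in> sols 1 N. a = b}
      + card {(a, b, x, y) \<in> sols 1 N. a < b \<and> b < 2 * a}"
    (is "card ?B + card ?L = 2 * card ?G + card ?D + card ?E")
proof -
  define X Y where "X = {(a, e, x, y) \<in> sols 2 (2 * N). a \<le> e \<and> even a}"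
    and "Y = {(a, e, x, y) \<in> sols 2 (2 * N). a \<le> e \<and> odd a}"
  define U V where "U = {(a, b, x, y) \<in> sols 1 N. a \<le> b \<and> odd a}"
    and "V = {(a, b, x, y) \<in> sols 1 N. a \<le> b \<and> even a}"
  note XY = \<open>X = _\<close> \<open>Y = _\<close> and UV = \<open>U = _\<close> \<open>V = _\<close>
  have fin: "finite X" "finite Y" "finite U" "finite V" "finite ?G" "finite ?D" "finite ?E"
    unfolding XY UV by (auto intro: finite_subset[OF _ finite_sols[of 2]] finite_subset[OF _ finite_sols[of 1]])
  \<comment> \<open>For even \<open>a\<close>, halving \<open>a\<close> turns
    \<open>a \<le> e\<close> into \<open>2 * a \<le> b\<close>.\<close>
  have "bij_betw (\<lambda>(a, b, x, y). (2 * a, b, x, y)) ?G X"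
  proof (rule bij_betw_byWitness[where f' = "\<lambda>(a, b, x, y). (a div 2, b, x, y)"])
    show "(\<lambda>(a, b, x, y). (2 * a, b, x, y)) ` ?G \<subseteq> X" by (auto simp: XY sols_def)
    show "(\<lambda>(a, b, x, y). (a div 2, b, x, y)) ` X \<subseteq> ?G"
      by (auto simp: XY sols_def elim!: evenE)
  qed (auto simp: XY)
  then have "card ?G = card X" by (rule bij_betw_same_card)
  \<comment> \<open>For odd \<open>a\<close> the multiplicity \<open>x\<close> must be even, and
    halving it leaves \<open>a \<le> b\<close> unchanged.\<close>
  moreover have "bij_betw (\<lambda>(a, b, x, y). (a, b, 2 * x, y)) U Y"
  proof (rule bij_betw_byWitness[where f' = "\<lambda>(a, b, x, y). (a, b, x div 2, y)"])
    have x: "even x" if "(a, b, x, y) \<in> Y" for a b x y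
    proof -
      have "a * x + 2 * (b * y) = 2 * N" "odd a" using that by (auto simp: XY sols_def)
      then have "even (a * x)" by (metis dvd_add_left_iff dvd_triv_left)
      then show ?thesis using \<open>odd a\<close> by simp
    qed
    show "\<forall>t\<in>Y. (\<lambda>(a, b, x, y). (a, b, 2 * x, y)) ((\<lambda>(a, b, x, y). (a, b, x div 2, y)) t) = t"
      using x by auto
    show "(\<lambda>(a, b, x, y). (a, b, 2 * x, y)) ` U \<subseteq> Y" by (auto simp: XY UV sols_def)
    show "(\<lambda>(a, b, x, y). (a, b, x div 2, y)) ` Y \<subseteq> U"
    proof (rule image_subsetI)
      fix t assume t: "t \<in> Y"
      obtain a b x y where tt: "t = (a, b, x, y)" by (cases t)
      then obtain z where "x = 2 * z" using x t by (blast elim: evenE)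
      then show "(\<lambda>(a, b, x, y). (a, b, x div 2, y)) t \<in> U" using t by (auto simp: tt XY UV sols_def)
    qed
  qed (auto simp: UV)
  then have "card U = card Y" by (rule bij_betw_same_card)
  \<comment> \<open>The correction term is read with the two sizes in the other order:
    \<open>2 * e\<close> is the smaller, even one. As \<open>N\<close> is odd, the other size is
    odd, so the weak inequality in \<open>V\<close> is automatically strict.\<close>
  moreover have "bij_betw (\<lambda>(a, e, x, y). (2 * e, a, y, x)) ?L V"
  proof (rule bij_betw_byWitness[where f' = "\<lambda>(a, b, x, y). (b, a div 2, y, x)"])
    show "(\<lambda>(a, e, x, y). (2 * e, a, y, x)) ` ?L \<subseteq> V" by (auto simp: UV sols_def)
    show "(\<lambda>(a, b, x, y). (b, a div 2, y, x)) ` V \<subseteq> ?L"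
    proof (rule image_subsetI)
      fix t assume t: "t \<in> V"
      obtain a b x y where tt: "t = (a, b, x, y)" by (cases t)
      then obtain c where c: "a = 2 * c" using t by (auto simp: UV elim: evenE)
      then have "odd (b * y)" using t \<open>odd N\<close> by (auto simp: tt UV sols_def)
      then have "b \<noteq> 2 * c" by auto
      then show "(\<lambda>(a, b, x, y). (b, a div 2, y, x)) t \<in> ?L"
        using t c by (auto simp: tt UV sols_def)
    qed
  qed (auto simp: UV)
  then have "card ?L = card V" by (rule bij_betw_same_card)
  moreover have "?B = X \<union> Y" "X \<inter> Y = {}" by (auto simp: XY)
  then have "card ?B = card X + card Y" using fin by (simp add: card_Un_disjoint)
  moreover have "card U + card V = card ?G + card ?D + card ?E"
  proof -
    have "U \<union> V = (?G \<union> ?D) \<union> ?E" by (auto simp: UV sols_def)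
    moreover have "U \<inter> V = {}" "?G \<inter> ?D = {}" "(?G \<union> ?D) \<inter> ?E = {}" by (auto simp: UV sols_def)
    ultimately show ?thesis using fin by (simp add: card_Un_disjoint[symmetric])
  qed
  ultimately show ?thesis by linarith
qed

text \<open>Every \<open>b < 2 * a\<close> is admissible; from \<open>2 * a\<close> on only even
  \<open>b = 2 * e\<close> are, and then \<open>2 * a \<le> b\<close> becomes
  \<open>a \<le> e\<close>.\<close>

lemma card_two_sizes_split:
  "card {(a, b, x, y) \<in> sols 1 n. a < b \<and> (odd b \<longrightarrow> b < 2 * a)} =
    card {(a, b, x, y) \<in> sols 1 n. a < b \<and> b < 2 * a} + card {(a, e, x, y) \<in> sols 2 n. a \<le> e}"
    (is "card ?A = card ?E + card ?B")
proof -
  define C where "C = {(a, b, x, y) \<in> sols 1 n. 2 * a \<le> b \<and> even b}"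
  have fin: "finite ?E" "finite C"
    unfolding C_def by (auto intro: finite_subset[OF _ finite_sols[of 1]])
  have "?A = ?E \<union> C" "?E \<inter> C = {}" by (auto simp: C_def sols_def)
  then have "card ?A = card ?E + card C" using fin by (simp add: card_Un_disjoint)
  moreover have "bij_betw (\<lambda>(a, e, x, y). (a, 2 * e, x, y)) ?B C"
  proof (rule bij_betw_byWitness[where f' = "\<lambda>(a, b, x, y). (a, b div 2, x, y)"])
    show "(\<lambda>(a, e, x, y). (a, 2 * e, x, y)) ` ?B \<subseteq> C" by (auto simp: C_def sols_def)
    show "(\<lambda>(a, b, x, y). (a, b div 2, x, y)) ` C \<subseteq> ?B" by (auto simp: C_def sols_def elim!: evenE)
  qed (auto simp: C_def)
  then have "card ?B = card C" by (rule bij_betw_same_card)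
  ultimately show ?thesis by simp
qed

subsection \<open>Overpartitions modulo 4\<close>

lemma card_subsets_containing:
  assumes "finite A" "m \<in> A"
  shows "card {S. S \<subseteq> A \<and> m \<in> S} = 2 ^ (card A - 1)"
proof -
  have "{S. S \<subseteq> A \<and> m \<in> S} = insert m ` Pow (A - {m})"
  proof (intro set_eqI iffI)
    fix S assume "S \<in> {S. S \<subseteq> A \<and> m \<in> S}"
    then have "S = insert m (S - {m})" "S - {m} \<in> Pow (A - {m})" by auto
    then show "S \<in> insert m ` Pow (A - {m})" by blast
  qed (use assms in auto)
  moreover have "inj_on (insert m) (Pow (A - {m}))" by (auto simp: inj_on_def)
  ultimately show ?thesis using assms by (simp add: card_image card_Pow card_Diff_singleton)
qed

lemma finite_partitions: "finite {M :: nat multiset. (\<forall>x\<in>#M. 0 < x) \<and> sum_mset M = n}"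
proof (rule finite_subset)
  show "{M. (\<forall>x\<in>#M. 0 < x) \<and> sum_mset M = n} \<subseteq> mset ` {xs. set xs \<subseteq> {..n} \<and> length xs \<le> n}"
  proof clarify
    fix M :: "nat multiset" assume pos: "\<forall>x\<in>#M. 0 < x" and n: "n = sum_mset M"
    have "size M \<le> sum_mset M" using pos by (induction M) auto
    moreover have "x \<le> sum_mset M" if "x \<in># M" for x using that by (metis multi_member_split sum_mset.add_mset le_add1)
    moreover obtain xs where "M = mset xs" by (metis ex_mset)
    ultimately show "M \<in> mset ` {xs. set xs \<subseteq> {..sum_mset M} \<and> length xs \<le> sum_mset M}" by auto
  qed
qed (simp add: finite_lists_length_le)

text \<open>The underlying partitions with the overlines forgotten; the requirement that the
  smallest part is overlined moves to the choice of the set \<open>S\<close> over each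
  \<open>M\<close>.\<close>

definition omega_partitions :: "nat \<Rightarrow> nat multiset set" where
  "omega_partitions n = {M. (\<forall>x\<in>#M. 0 < x) \<and> sum_mset M = n \<and> M \<noteq> {#} \<and>
      (\<forall>x\<in>#M. odd x \<longrightarrow> x < 2 * Min (set_mset M))}"

text \<open>With \<open>k\<close> distinct sizes the overline on the smallest is forced and the
  others are free, giving \<open>2 ^ (k - 1)\<close> overlinings. This is 1 for
  \<open>k = 1\<close>, 2 for \<open>k = 2\<close>, and a multiple of 4 from \<open>k = 3\<close>
  on.\<close>

lemma pbar_omega_mod_4_omega_partitions:
  "pbar_omega n mod 4 = (card {M \<in> omega_partitions n. card (set_mset M) = 1}
      + 2 * card {M \<in> omega_partitions n. card (set_mset M) = 2}) mod 4"
proof -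
  let ?W = "omega_partitions n"
  have fin: "finite ?W" unfolding omega_partitions_def by (rule finite_subset[OF _ finite_partitions[of n]]) auto
  have "{(M, S) \<in> overpartitions n. M \<noteq> {#} \<and> Min (set_mset M) \<in> S \<and>
      (\<forall>x\<in>#M. odd x \<longrightarrow> x < 2 * Min (set_mset M))} =
    (SIGMA M:?W. {S. S \<subseteq> set_mset M \<and> Min (set_mset M) \<in> S})"
    unfolding overpartitions_def omega_partitions_def by auto
  then have "pbar_omega n = (\<Sum>M\<in>?W. card {S. S \<subseteq> set_mset M \<and> Min (set_mset M) \<in> S})"
    unfolding pbar_omega_def using fin by (simp add: card_SigmaI)
  also have "\<dots> = (\<Sum>M\<in>?W. 2 ^ (card (set_mset M) - 1))"
    by (intro sum.cong refl card_subsets_containing) (auto simp: omega_partitions_def)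
  also have "\<dots> = (\<Sum>M\<in>?W. of_bool (card (set_mset M) = 1) + 2 * of_bool (card (set_mset M) = 2)
      + 4 * (if card (set_mset M) \<ge> 3 then 2 ^ (card (set_mset M) - 3) else 0))"
  proof (intro sum.cong refl)
    fix M assume "M \<in> ?W"
    then have "card (set_mset M) \<noteq> 0" by (simp add: omega_partitions_def)
    then consider "card (set_mset M) = 1" | "card (set_mset M) = 2" | "card (set_mset M) \<ge> 3" by linarith
    then show "2 ^ (card (set_mset M) - 1) = of_bool (card (set_mset M) = 1) + 2 * of_bool (card (set_mset M) = 2)
      + 4 * (if card (set_mset M) \<ge> 3 then 2 ^ (card (set_mset M) - 3) else (0::nat))"
    proof cases
      case 3
      then obtain k where "card (set_mset M) = 3 + k" using le_Suc_ex by blast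
      then show ?thesis by simp
    qed simp_all
  qed
  also have "\<dots> = card {M \<in> ?W. card (set_mset M) = 1} + 2 * card {M \<in> ?W. card (set_mset M) = 2}
      + 4 * (\<Sum>M\<in>?W. if card (set_mset M) \<ge> 3 then 2 ^ (card (set_mset M) - 3) else 0)"
    using fin by (simp add: sum.distrib sum_distrib_left[symmetric] Int_def)
  finally show ?thesis by simp
qed

text \<open>A divisor \<open>m\<close> corresponds to \<open>n div m\<close> copies of
  \<open>m\<close>; the bound on odd parts reads \<open>m < 2 * m\<close> and holds
  automatically.\<close>

lemma card_one_part_size:
  assumes "0 < n"
  shows "card {M \<in> omega_partitions n. card (set_mset M) = 1} = card {m. m dvd n}"
proof -
  have pos: "0 < m \<and> 0 < n div m \<and> n div m * m = n" if "m dvd n" for m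
    using that assms by (auto elim!: dvdE)
  have "bij_betw (\<lambda>m. replicate_mset (n div m) m) {m. m dvd n} {M \<in> omega_partitions n. card (set_mset M) = 1}"
    (is "bij_betw ?f ?A ?B")
  proof (rule bij_betw_imageI)
    have set: "set_mset (?f m) = {m}" if "m dvd n" for m using pos[OF that] by simp
    show "inj_on ?f ?A" by (rule inj_onI) (metis mem_Collect_eq set singleton_inject)
    show "?f ` ?A = ?B"
    proof (intro set_eqI iffI)
      fix M assume "M \<in> ?f ` ?A"
      then obtain m where "M = ?f m" "m dvd n" by auto
      then show "M \<in> ?B" using pos[of m] set[of m] by (simp add: omega_partitions_def sum_mset_replicate_mset)
    next
      fix M assume M: "M \<in> ?B"
      then obtain m where m: "set_mset M = {m}" by (auto simp: card_1_singleton_iff)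
      then have r: "M = replicate_mset (size M) m" by (metis set_mset_subset_singletonD subset_refl)
      then have "sum_mset M = size M * m" by (metis sum_mset_replicate_mset of_nat_id)
      then have "n = size M * m" "0 < m" using M m by (auto simp: omega_partitions_def)
      then show "M \<in> ?f ` ?A" using r by (intro image_eqI[of _ _ m]) auto
    qed
  qed
  then show ?thesis by (simp add: bij_betw_same_card)
qed

text \<open>The smaller size \<open>a\<close> is the minimum and meets the bound on odd parts by
  itself, so only \<open>b\<close> is constrained.\<close>

lemma card_two_part_sizes:
  "card {M \<in> omega_partitions n. card (set_mset M) = 2} =
    card {(a, b, x, y) \<in> sols 1 n. a < b \<and> (odd b \<longrightarrow> b < 2 * a)}"
proof -
  define f where "f = (\<lambda>(a, b, x, y). replicate_mset x a + replicate_mset y b :: nat multiset)"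
  have "bij_betw f {(a, b, x, y) \<in> sols 1 n. a < b \<and> (odd b \<longrightarrow> b < 2 * a)} {M \<in> omega_partitions n. card (set_mset M) = 2}"
    (is "bij_betw f ?A ?B")
  proof (rule bij_betw_imageI)
    show "inj_on f ?A"
    proof (rule inj_onI)
      fix s t assume st: "s \<in> ?A" "t \<in> ?A" "f s = f t"
      obtain a b x y where s: "s = (a, b, x, y)" by (cases s)
      obtain a' b' x' y' where t: "t = (a', b', x', y')" by (cases t)
      have lt: "a < b" "a' < b'" "0 < x" "0 < y" "0 < x'" "0 < y'" using st by (auto simp: s t sols_def)
      have eq: "replicate_mset x a + replicate_mset y b = replicate_mset x' a' + replicate_mset y' b'"
        using st by (simp add: s t f_def)
      have "{a, b} = set_mset (replicate_mset x a + replicate_mset y b)" using lt by (simp add: insert_commute)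
      also have "\<dots> = {a', b'}" unfolding eq using lt by (simp add: insert_commute)
      finally have "{a, b} = {a', b'}" .
      then have ab: "a = a'" "b = b'" using lt by (auto simp: doubleton_eq_iff)
      have "x = x'" using arg_cong[OF eq, of "\<lambda>M. count M a"] lt unfolding ab by simp
      moreover have "y = y'" using arg_cong[OF eq, of "\<lambda>M. count M b"] lt unfolding ab by simp
      ultimately show "s = t" using ab s t by simp
    qed
    show "f ` ?A = ?B"
    proof (intro set_eqI iffI)
      fix M assume "M \<in> f ` ?A"
      then obtain a b x y where t: "(a, b, x, y) \<in> sols 1 n" "a < b" "odd b \<longrightarrow> b < 2 * a"
        and M: "M = replicate_mset x a + replicate_mset y b" by (auto simp: f_def)
      have set: "set_mset M = {a, b}" using t by (auto simp: M sols_def)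
      moreover have "sum_mset M = n" using t by (simp add: M sols_def sum_mset_replicate_mset mult.commute)
      moreover have "0 < a" "M \<noteq> {#}" using t set by (auto simp: sols_def)
      moreover have "Min {a, b} = a" using t by simp
      ultimately show "M \<in> ?B" using t by (simp add: omega_partitions_def)
    next
      fix M assume M: "M \<in> ?B"
      then obtain u v where "set_mset M = {u, v}" "u \<noteq> v" by (auto simp: card_2_iff)
      then obtain a b where set: "set_mset M = {a, b}" and ab: "a < b" by (metis insert_commute linorder_less_linear)
      define x y where "x = count M a" and "y = count M b"
      have eq: "M = replicate_mset x a + replicate_mset y b"
      proof (rule multiset_eqI)
        fix z show "count M z = count (replicate_mset x a + replicate_mset y b) z"
        proof (cases "z \<in># M")
          case True then show ?thesis using set ab by (auto simp: x_def y_def)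
        next
          case False
          then have "count M z = 0" "z \<noteq> a" "z \<noteq> b" using set by (auto simp: count_eq_zero_iff)
          then show ?thesis by simp
        qed
      qed
      have "0 < x" "0 < y" using set by (auto simp: x_def y_def)
      moreover have "0 < a" "sum_mset M = n" "odd b \<longrightarrow> b < 2 * a"
        using M set ab by (auto simp: omega_partitions_def)
      moreover have "sum_mset M = a * x + b * y" by (subst eq) (simp add: sum_mset_replicate_mset mult.commute)
      ultimately have "(a, b, x, y) \<in> ?A" using ab by (simp add: sols_def)
      then show "M \<in> f ` ?A" using eq by (intro image_eqI[of _ _ "(a, b, x, y)"]) (simp_all add: f_def)
    qed
  qed
  then show ?thesis by (simp add: bij_betw_same_card)
qed

section \<open>Reduction to divisors and even larger sizes, and the two congruences\<close>

lemma pbar_omega_mod_4: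
  assumes "0 < n" "n mod 4 = 3 \<or> n mod 8 = 6"
  shows "pbar_omega n mod 4 = (card {m. m dvd n} + 2 * card {(a, e, x, y) \<in> sols 2 n. a \<le> e}) mod 4"
proof -
  obtain k where "card {(a, b, x, y) \<in> sols 1 n. a < b \<and> b < 2 * a} = 2 * k"
    using even_card_between[OF assms(2)] by (elim evenE)
  \<comment> \<open>The solutions with \<open>a < b < 2 * a\<close> enter with factor 2 and are even
    in number, so they contribute \<open>4 * k\<close>.\<close>
  then have "pbar_omega n mod 4 = (card {m. m dvd n} + 2 * card {(a, e, x, y) \<in> sols 2 n. a \<le> e} + 4 * k) mod 4"
    unfolding pbar_omega_mod_4_omega_partitions card_one_part_size[OF assms(1)] card_two_part_sizes
      card_two_sizes_split by (simp add: algebra_simps)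
  then show ?thesis by simp
qed

text \<open>Each codivisor pair consists of one divisor that is 1 and one that is 3 modulo 4, so its
  sum is a multiple of 4 and it adds 2 to the count.\<close>

lemma dvd_sum_divisors:
  assumes "n mod 4 = 3"
  shows "4 dvd (\<Sum>m | m dvd n. m :: nat)" and "even (card {m. m dvd n})"
proof -
  have "4 dvd m + n div m" if "m dvd n" "m mod 4 = 1" for m
    using codivisor_mod(1)[OF that assms] that(2) mod_add_eq[of m 4 "n div m"]
    by (simp add: dvd_eq_mod_eq_0)
  then show "4 dvd (\<Sum>m | m dvd n. m)"
    unfolding sum_divisors_mod_4_eq_3[OF assms] by (intro dvd_sum) auto
  have "card {m. m dvd n} = (\<Sum>m | m dvd n. 1)" by simp
  also have "\<dots> = (\<Sum>m | m dvd n \<and> m mod 4 = 1. 2)"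
    unfolding sum_divisors_mod_4_eq_3[OF assms] by simp
  finally show "even (card {m. m dvd n})" by simp
qed

lemma card_divisors_double:
  fixes N :: nat
  assumes "odd N"
  shows "card {m. m dvd 2 * N} = 2 * card {m. m dvd N}"
proof -
  have "0 < N" using assms by (cases N) auto
  have "{m. m dvd 2 * N} = {m. m dvd N} \<union> (*) 2 ` {m. m dvd N}"
  proof (intro set_eqI iffI)
    fix m assume m: "m \<in> {m. m dvd 2 * N}"
    show "m \<in> {m. m dvd N} \<union> (*) 2 ` {m. m dvd N}"
    proof (cases "even m")
      case True
      then show ?thesis using m by (auto elim!: evenE)
    next
      case False
      then have "coprime m 2" by simp
      then show ?thesis using m by (simp add: coprime_dvd_mult_right_iff)
    qed
  qed auto
  moreover have "{m. m dvd N} \<inter> (*) 2 ` {m. m dvd N} = {}" using assms dvd_trans[of 2 _ N] by auto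
  ultimately show ?thesis using \<open>0 < N\<close> by (simp add: card_Un_disjoint card_image inj_on_def)
qed

lemma pbar_omega_3_mod_4:
  assumes n: "n mod 4 = 3"
  shows "pbar_omega n mod 4 = 0"
proof -
  have n0: "0 < n" using n by (cases n) auto
  have "odd n" using n by presburger
  \<comment> \<open>The conjunct \<open>True\<close> keeps the set in the shape of
    \<open>card_diagonal\<close> with a trivial predicate.\<close>
  let ?D = "{(a, e, x, y) \<in> sols 2 n. a = e \<and> True}" and ?R = "{(a, e, x, y) \<in> sols 2 n. a < e}"
  have "{(a, e, x, y) \<in> sols 2 n. a \<le> e} = ?D \<union> ?R" "?D \<inter> ?R = {}" by auto
  moreover have "finite ?D" "finite ?R" by (auto intro: finite_subset[OF _ finite_sols[of 2 n]])
  ultimately have B: "card {(a, e, x, y) \<in> sols 2 n. a \<le> e} = card ?D + card ?R"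
    by (simp only: card_Un_disjoint)
  have "card ?D = (\<Sum>m | m dvd n. (m - 1) div 2)"
    using card_diagonal[OF n0, of "\<lambda>_. True"] by (simp add: card_half_mod_2)
  \<comment> \<open>Each divisor \<open>m\<close> counts once by itself and
    \<open>2 * ((m - 1) div 2)\<close> times through the diagonal. As \<open>m\<close> is odd this
    totals \<open>m\<close>, so the divisor sum appears.\<close>
  then have "card {m. m dvd n} + 2 * card ?D = (\<Sum>m | m dvd n. 1 + 2 * ((m - 1) div 2))"
    unfolding sum.distrib sum_distrib_left[symmetric] by simp
  also have "\<dots> = (\<Sum>m | m dvd n. m)"
  proof (intro sum.cong refl)
    fix m assume "m \<in> {m. m dvd n}"
    then have "odd m" using \<open>odd n\<close> by (auto intro: dvd_trans)
    then show "1 + 2 * ((m - 1) div 2) = m" by (auto elim!: oddE)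
  qed
  finally have "4 dvd card {m. m dvd n} + 2 * card ?D" using dvd_sum_divisors(1)[OF n] by simp
  moreover have "4 dvd 2 * card ?R" using even_card_right[OF n] by (auto elim!: evenE)
  ultimately have "4 dvd (card {m. m dvd n} + 2 * card ?D) + 2 * card ?R" by (rule dvd_add)
  then show ?thesis unfolding pbar_omega_mod_4[OF n0 disjI1[OF n]] B by (simp add: algebra_simps)
qed

lemma pbar_omega_6_mod_8:
  assumes N: "N mod 4 = 3"
  shows "pbar_omega (2 * N) mod 4 = 0"
proof -
  have "odd N" using N by presburger
  have "2 * N mod 8 = 6" using mult_mod_right[of 2 N 4] N by simp
  \<comment> \<open>On the right of \<open>card_sols_double\<close> one term is doubled, and the
    other two are even by involutions for \<open>N\<close>.\<close>
  have "even (card {(a, e, x, y) \<in> sols 2 (2 * N). a \<le> e} + card {(a, e, x, y) \<in> sols 2 N. 2 * e < a})"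
    unfolding card_sols_double[OF \<open>odd N\<close>]
    using even_card_equal[OF \<open>odd N\<close>] even_card_between[OF disjI1[OF N]] by simp
  then have "even (card {(a, e, x, y) \<in> sols 2 (2 * N). a \<le> e})" using even_card_left[OF N] by simp
  then have "4 dvd 2 * card {(a, e, x, y) \<in> sols 2 (2 * N). a \<le> e}" by (elim evenE) simp
  moreover have "4 dvd card {m. m dvd 2 * N}"
    unfolding card_divisors_double[OF \<open>odd N\<close>] using dvd_sum_divisors(2)[OF N] by (elim evenE) simp
  ultimately have "4 dvd card {m. m dvd 2 * N} + 2 * card {(a, e, x, y) \<in> sols 2 (2 * N). a \<le> e}"
    by (intro dvd_add)
  moreover have "0 < 2 * N" using \<open>odd N\<close> by (cases N) auto
  ultimately show ?thesis using pbar_omega_mod_4[of "2 * N"] \<open>2 * N mod 8 = 6\<close> by simp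
qed

theorem theorem1p4:
  fixes n :: nat
  shows "pbar_omega (4 * n + 3) mod 4 = 0 \<and> pbar_omega (8 * n + 6) mod 4 = 0"
proof
  have 3: "(4 * n + 3) mod 4 = 3" by simp
  show "pbar_omega (4 * n + 3) mod 4 = 0" by (rule pbar_omega_3_mod_4[OF 3])
  show "pbar_omega (8 * n + 6) mod 4 = 0" using pbar_omega_6_mod_8[OF 3] by simp
qed

end
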